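(* Let $(f_\lambda)_{\lambda\in I}$ be a one-parameter family of probability densities satisfying the standing assumptions of the context, let $X$ have pdf $f_\lambda$, and let $K<\Omega$. Let $\varphi:\mathbb{R}\to\mathbb{R}$ be a strictly increasing, twice differentiable function such that $\varphi(\Omega)=\Omega$ and $\frac{d\varphi}{dx}(x)>0$ for any $x<\Omega$. Let $g_\lambda$ be the pdf of $Y=\varphi(X)$. The random variable $Y$ is more fragile at level $L=\varphi(K)$ and pdf $g_\lambda$ than $X$ at level $K$ and pdf $f_\lambda$, i.e. $$V(Y,g_\lambda,L,u^-(\lambda))>V(X,f_\lambda,K,s^-(\lambda)),$$ if and only if $$\int_{-\infty}^{\Omega}H_\lambda^K(x)\,\frac{d^2\varphi}{dx^2}(x)\,dx<0,$$ where $$H_\lambda^K(x)=\frac{\partial P_\lambda^K}{\partial\lambda}(x)\Big/\frac{\partial P_\lambda^K}{\partial\lambda}(\Omega)\;-\;\frac{\partial P_\lambda}{\partial\lambda}(x)\Big/\frac{\partial P_\lambda}{\partial\lambda}(\Omega),$$ and where $P_\lambda(x)=\int_{-\infty}^{x}F_\lambda(t)\,dt$ is the price of the "put option" on $X$ (with pdf $f_\lambda$) with "strike" $x$, and $P_\lambda^K(x)=\int_{-\infty}^{x}F_\lambda^K(t)\,dt$ is that of a "put option" with "strike" $x$ and "European down-and-in barrier" at $K$.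
   Context: $I\subset\mathbb{R}$, $\lambda\in I$ is a parameter, $X$ is a real random variable whose distribution has pdf $f_\lambda$, and $\Omega\in\mathbb{R}$ is a fixed reference value. Put $F_\lambda(x)=\int_{-\infty}^{x}f_\lambda(t)\,dt$ and, for $K<\Omega$, $F_\lambda^K(x)=F_\lambda(\min(x,K))=\min(F_\lambda(x),F_\lambda(K))$. The left semi-absolute deviation of $X$ is $s^-(\lambda)=\int_{-\infty}^{\Omega}(\Omega-x)f_\lambda(x)\,dx=\int_{-\infty}^{\Omega}F_\lambda(x)\,dx$. Standing assumptions: $\lambda\mapsto s^-(\lambda)$ is continuous, strictly increasing and spans the whole range $[0,+\infty)$, with inverse function $s\mapsto\lambda(s)$; $\frac{\partial F_\lambda}{\partial\lambda}(x)>0$ for any $x<\Omega$; and the tail shortfall $\xi(K,s^-)=\int_{-\infty}^{K}(\Omega-x)f_{\lambda(s^-)}(x)\,dx$ is differentiable on $(-\infty,\Omega]\times[0,\infty)$. The (intrinsic) fragility of $X$, i.e. its $K$-left-tail-vega sensitivity, at stress level $K<\Omega$ and deviation level $s^-=s^-(\lambda)>0$, is $$V(X,f_\lambda,K,s^-)=\frac{\partial\xi}{\partial s^-}(K,s^-)=\Big(\int_{-\infty}^{K}(\Omega-x)\frac{\partial f_\lambda}{\partial\lambda}(x)\,dx\Big)\Big(\frac{ds^-}{d\lambda}\Big)^{-1}.$$ For $Y=\varphi(X)$ with pdf $g_\lambda$, the reference value is $\varphi(\Omega)=\Omega$, the left semi-absolute deviation is $u^-(\lambda)=\int_{-\infty}^{\Omega}(\Omega-y)g_\lambda(y)\,dy$,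 the tail shortfall is $\zeta(L,u^-(\lambda))=\int_{-\infty}^{L}(\Omega-y)g_\lambda(y)\,dy$, and the fragility $V(Y,g_\lambda,L,u^-(\lambda))=\frac{\partial\zeta}{\partial u^-}(L,u^-(\lambda))$ is defined in the same way as for $X$, with $(Y,g_\lambda,L,u^-)$ in place of $(X,f_\lambda,K,s^-)$ (differentiation is with respect to the semi-deviation of $Y$ itself). *)

theory Defs
  imports "HOL-Probability.Probability"
begin

text \<open>
  A one-parameter family of densities is a function \<open>f\<close>, where \<open>f l x\<close> is the density with
  parameter \<open>l\<close> at the point \<open>x\<close>. Every notion below takes the family as an argument, so that it
  applies verbatim both to \<open>X\<close> (family \<open>f\<close>) and to \<open>Y\<close> (family \<open>g\<close>).
\<close>

definition dist_fun :: "(real \<Rightarrow> real \<Rightarrow> real) \<Rightarrow> real \<Rightarrow> real \<Rightarrow> real" where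
  "dist_fun f l x = (LINT t:{..x}|lborel. f l t)"

definition capped_dist_fun :: "(real \<Rightarrow> real \<Rightarrow> real) \<Rightarrow> real \<Rightarrow> real \<Rightarrow> real \<Rightarrow> real" where
  "capped_dist_fun f K l x = dist_fun f l (min x K)"

definition put_price :: "(real \<Rightarrow> real \<Rightarrow> real) \<Rightarrow> real \<Rightarrow> real \<Rightarrow> real" where
  "put_price f l x = (LINT t:{..x}|lborel. dist_fun f l t)"

definition barrier_put_price :: "(real \<Rightarrow> real \<Rightarrow> real) \<Rightarrow> real \<Rightarrow> real \<Rightarrow> real \<Rightarrow> real" where
  "barrier_put_price f K l x = (LINT t:{..x}|lborel. capped_dist_fun f K l t)"

definition semi_deviation :: "real \<Rightarrow> (real \<Rightarrow> real \<Rightarrow> real) \<Rightarrow> real \<Rightarrow> real" where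
  "semi_deviation \<Omega> f l = (LINT x:{..\<Omega>}|lborel. (\<Omega> - x) * f l x)"

definition param_of_deviation :: "real \<Rightarrow> real set \<Rightarrow> (real \<Rightarrow> real \<Rightarrow> real) \<Rightarrow> real \<Rightarrow> real" where
  "param_of_deviation \<Omega> I f = inv_into I (semi_deviation \<Omega> f)"

definition shortfall :: "real \<Rightarrow> real set \<Rightarrow> (real \<Rightarrow> real \<Rightarrow> real) \<Rightarrow> real \<Rightarrow> real \<Rightarrow> real" where
  "shortfall \<Omega> I f K s = (LINT x:{..K}|lborel. (\<Omega> - x) * f (param_of_deviation \<Omega> I f s) x)"

definition fragility :: "real \<Rightarrow> real set \<Rightarrow> (real \<Rightarrow> real \<Rightarrow> real) \<Rightarrow> real \<Rightarrow> real \<Rightarrow> real" where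
  "fragility \<Omega> I f K s = deriv (shortfall \<Omega> I f K) s"

text \<open>
  The defining display of the fragility at deviation level \<open>s\<^sup>-(l)\<close> makes sense and its two sides
  agree at every stress level \<open>K < \<Omega>\<close>, that is,
  \<open>\<partial>\<xi>/\<partial>s\<^sup>- = (\<integral>\<^bsub>-\<infinity>\<^esub>\<^bsup>K\<^esup> (\<Omega> - x) (\<partial>f\<^bsub>l\<^esub>/\<partial>l)(x) dx) (ds\<^sup>-/dl)\<^bsup>-1\<^esup>\<close>.
  The equality is a condition: it presupposes differentiation under the integral sign, which
  can fail when mass escapes to \<open>-\<infinity>\<close>. The derivative of \<open>f\<close> is only required almost everywhere
  because a density is only determined up to null sets.
\<close>

definition fragility_well_defined ::
    "real \<Rightarrow> real set \<Rightarrow> (real \<Rightarrow> real \<Rightarrow> real) \<Rightarrow> real \<Rightarrow> bool" where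
  "fragility_well_defined \<Omega> I f l \<longleftrightarrow>
     (\<forall>m\<in>I. set_integrable lborel {..\<Omega>} (\<lambda>x. (\<Omega> - x) * f m x)) \<and>
     semi_deviation \<Omega> f differentiable (at l) \<and>
     (AE x in lborel. x < \<Omega> \<longrightarrow> (\<lambda>m. f m x) differentiable (at l)) \<and>
     (\<forall>K<\<Omega>.
        set_integrable lborel {..K} (\<lambda>x. (\<Omega> - x) * deriv (\<lambda>m. f m x) l) \<and>
        (shortfall \<Omega> I f K has_real_derivative
           (LINT x:{..K}|lborel. (\<Omega> - x) * deriv (\<lambda>m. f m x) l) / deriv (semi_deviation \<Omega> f) l)
          (at (semi_deviation \<Omega> f l)))"

text \<open>
  The derivative with respect to the parameter is taken within \<open>I\<close>: it is one-sided at the left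
  end point of \<open>I\<close>, where the semi-deviation vanishes.
\<close>

definition standing_assumptions :: "real \<Rightarrow> real set \<Rightarrow> (real \<Rightarrow> real \<Rightarrow> real) \<Rightarrow> bool" where
  "standing_assumptions \<Omega> I f \<longleftrightarrow>
     is_interval I \<and>
     (\<forall>l\<in>I. set_integrable lborel {..\<Omega>} (\<lambda>x. (\<Omega> - x) * f l x)) \<and>
     continuous_on I (semi_deviation \<Omega> f) \<and>
     strict_mono_on I (semi_deviation \<Omega> f) \<and>
     semi_deviation \<Omega> f ` I = {0..} \<and>
     (\<forall>l\<in>I. \<forall>x<\<Omega>. \<exists>D>0. ((\<lambda>m. dist_fun f m x) has_real_derivative D) (at l within I)) \<and>
     (\<lambda>(K, s). shortfall \<Omega> I f K s) differentiable_on ({..\<Omega>} \<times> {0..})"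

definition transfer_kernel ::
    "real \<Rightarrow> (real \<Rightarrow> real \<Rightarrow> real) \<Rightarrow> real \<Rightarrow> real \<Rightarrow> real \<Rightarrow> real" where
  "transfer_kernel \<Omega> f K l x =
     deriv (\<lambda>m. barrier_put_price f K m x) l / deriv (\<lambda>m. barrier_put_price f K m \<Omega>) l
     - deriv (\<lambda>m. put_price f m x) l / deriv (\<lambda>m. put_price f m \<Omega>) l"

end

theory Submission
  imports Defs
begin

text \<open>
  Write \<open>p x\<close> and \<open>r x\<close> for the parameter derivatives at \<open>l\<close> of the put prices on \<open>X\<close> with strike \<open>x\<close>
  and on \<open>Y\<close> with strike \<open>\<phi> x\<close>. By Tonelli the integral of \<open>(\<Omega> - t) f t\<close> over \<open>t \<le> K\<close> is
  \<open>(\<Omega> - K) F K + P K\<close>, which turns both fragilities into expressions in \<open>p\<close>, \<open>r\<close> and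
  \<open>d = \<partial>F\<^bsub>l\<^esub>(K)/\<partial>l\<close>. The Cauchy mean value theorem puts every increment of \<open>r\<close> between the
  extreme values of \<open>\<phi>'\<close> times the increment of \<open>p\<close>, that is \<open>dr = \<phi>' dp\<close>; integrating
  \<open>p \<phi>''\<close> by parts then expresses the integral of \<open>H \<phi>''\<close> through \<open>p\<close>, \<open>r\<close> and \<open>d\<close>. No interchange
  of \<open>\<partial>/\<partial>l\<close> with the integral of \<open>F\<close> is used: \<open>p\<close> need not be an antiderivative of \<open>\<partial>F/\<partial>l\<close>.
\<close>

subsection \<open>Integration by parts against a monotone function\<close>

text \<open>The assumption \<open>bounds\<close> is a form of \<open>dr = \<psi> dp\<close>, so this
  is integration by parts for a Stieltjes integral. \<open>p\<close> may jump and
  \<open>\<psi>'\<close> may be badly discontinuous, hence the gauge integral. On a short interval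
  the second mean value theorem and \<open>bounds\<close> compare both sides with the increment of
  \<open>p\<close> times values of \<open>\<psi>\<close>; the errors add up to at most a small
  multiple of \<open>p b - p a\<close>.\<close>

lemma has_integral_monotone_times_derivative:
  fixes \<psi> \<psi>' p r :: "real \<Rightarrow> real"
  assumes "a \<le> b"
    and der: "\<And>x. \<lbrakk>a \<le> x; x \<le> b\<rbrakk> \<Longrightarrow> (\<psi> has_real_derivative \<psi>' x) (at x)"
    and mono: "\<And>x y. \<lbrakk>a \<le> x; x \<le> y; y \<le> b\<rbrakk> \<Longrightarrow> p x \<le> p y"
    and bounds: "\<And>u v lo hi. \<lbrakk>a \<le> u; u \<le> v; v \<le> b; \<And>x. \<lbrakk>u \<le> x; x \<le> v\<rbrakk> \<Longrightarrow> lo \<le> \<psi> x \<and> \<psi> x \<le> hi\<rbrakk>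
      \<Longrightarrow> lo * (p v - p u) \<le> r v - r u \<and> r v - r u \<le> hi * (p v - p u)"
  shows "((\<lambda>x. p x * \<psi>' x) has_integral (p b * \<psi> b - p a * \<psi> a - (r b - r a))) {a..b}"
proof -
  have ftc: "(\<psi>' has_integral \<psi> v - \<psi> u) {u..v}" if "a \<le> u" "u \<le> v" "v \<le> b" for u v
    using that der
    by (intro fundamental_theorem_of_calculus)
       (auto simp flip: has_real_derivative_iff_has_vector_derivative
             intro: has_field_derivative_at_within)
  \<comment> \<open>The second mean value theorem puts \<open>p u\<close> on \<open>{u..c}\<close>
    and \<open>p v\<close> on \<open>{c..v}\<close>; regrouping isolates the boundary term and a
    single value \<open>\<psi> c\<close>.\<close>
  have mvt: "\<exists>c. u \<le> c \<and> c \<le> v \<and>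
      ((\<lambda>x. p x * \<psi>' x) has_integral p v * \<psi> v - p u * \<psi> u - \<psi> c * (p v - p u)) {u..v}"
    if uv: "a \<le> u" "u \<le> v" "v \<le> b" for u v
  proof -
    have "\<psi>' integrable_on {u..v}"
      using ftc[OF uv] by blast
    moreover have "\<And>x y. \<lbrakk>u \<le> x; x \<le> y; y \<le> v\<rbrakk> \<Longrightarrow> p x \<le> p y"
      using mono uv by auto
    ultimately obtain c where c: "c \<in> {u..v}"
      "((\<lambda>x. p x * \<psi>' x) has_integral (p u * integral {u..c} \<psi>' + p v * integral {c..v} \<psi>')) {u..v}"
      using second_mean_value_theorem_full[OF _ \<open>u \<le> v\<close>, of \<psi>' p] by blast
    have "integral {u..c} \<psi>' = \<psi> c - \<psi> u" "integral {c..v} \<psi>' = \<psi> v - \<psi> c"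
      using ftc[of u c] ftc[of c v] c uv by (auto intro!: integral_unique)
    then have eq: "p u * integral {u..c} \<psi>' + p v * integral {c..v} \<psi>'
      = p v * \<psi> v - p u * \<psi> u - \<psi> c * (p v - p u)"
      by (simp only:) (simp add: algebra_simps)
    show ?thesis using c unfolding eq by auto
  qed
  \<comment> \<open>\<open>D u v\<close> is the defect of the claimed formula on
    \<open>{u..v}\<close>. It is additive over adjacent intervals, and so is the bound
    \<open>e * (p v - p u)\<close>, which makes bisection applicable.\<close>
  define D where "D u v = integral {u..v} (\<lambda>x. p x * \<psi>' x) - (p v * \<psi> v - p u * \<psi> u) + (r v - r u)"
    for u v
  have int: "(\<lambda>x. p x * \<psi>' x) integrable_on {u..v}" if "a \<le> u" "u \<le> v" "v \<le> b" for u v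
    using mvt[OF that] by blast
  have small: "\<bar>D a b\<bar> \<le> e * (p b - p a)" if "e > 0" for e
  proof -
    \<comment> \<open>\<open>Bolzano\<close> quantifies over intervals that may leave
      \<open>{a..b}\<close>, hence the two guards.\<close>
    define P where "P u v \<longleftrightarrow> a \<le> u \<longrightarrow> v \<le> b \<longrightarrow> \<bar>D u v\<bar> \<le> e * (p v - p u)" for u v
    have "P a b"
      using \<open>a \<le> b\<close>
    proof (induction rule: Bolzano)
      case (trans u v w)
      show ?case
        unfolding P_def
      proof (intro impI)
        assume *: "a \<le> u" "w \<le> b"
        have uvw: "u \<le> v" "v \<le> w"
          using trans by blast+
        have "integral {u..v} (\<lambda>x. p x * \<psi>' x) + integral {v..w} (\<lambda>x. p x * \<psi>' x)
            = integral {u..w} (\<lambda>x. p x * \<psi>' x)"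
          using uvw * by (intro Henstock_Kurzweil_Integration.integral_combine int) auto
        then have "D u w = D u v + D v w"
          by (simp add: D_def)
        moreover have "\<bar>D u v\<bar> \<le> e * (p v - p u)" "\<bar>D v w\<bar> \<le> e * (p w - p v)"
          using trans uvw * by (auto simp: P_def)
        ultimately show "\<bar>D u w\<bar> \<le> e * (p w - p u)"
          by (simp add: algebra_simps)
      qed
    next
      case (local x)
      have "isCont \<psi> x"
        using der[of x] local DERIV_isCont by blast
      \<comment> \<open>With tolerance \<open>e / 2\<close> the values of \<open>\<psi>\<close> near
        \<open>x\<close> lie in a band of width \<open>e\<close>; both \<open>r v - r u\<close> and
        \<open>\<psi> c * (p v - p u)\<close> lie in that band times the increment of
        \<open>p\<close>.\<close>
      then obtain d where d: "d > 0" "\<And>y. \<bar>y - x\<bar> < d \<Longrightarrow> \<bar>\<psi> y - \<psi> x\<bar> < e / 2"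
        using \<open>e > 0\<close> unfolding continuous_at_real_range by (metis half_gt_zero real_norm_def)
      show ?case
        unfolding P_def
      proof (intro exI[of _ d] conjI allI impI)
        fix u v assume uv: "u \<le> x \<and> x \<le> v \<and> v - u < d" "a \<le> u" "v \<le> b"
        then have near: "\<psi> x - e / 2 \<le> \<psi> y \<and> \<psi> y \<le> \<psi> x + e / 2" if "u \<le> y" "y \<le> v" for y
        proof -
          have "\<bar>y - x\<bar> < d" using uv that by linarith
          then show ?thesis using d(2)[of y] by linarith
        qed
        have "u \<le> v" using uv by auto
        obtain c where c: "u \<le> c" "c \<le> v"
          "((\<lambda>x. p x * \<psi>' x) has_integral p v * \<psi> v - p u * \<psi> u - \<psi> c * (p v - p u)) {u..v}"
          using mvt[OF uv(2) \<open>u \<le> v\<close> uv(3)] by blast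
        have "D u v = (r v - r u) - \<psi> c * (p v - p u)"
          unfolding D_def integral_unique[OF c(3)] by simp
        moreover have "(\<psi> x - e / 2) * (p v - p u) \<le> r v - r u"
          "r v - r u \<le> (\<psi> x + e / 2) * (p v - p u)"
          using bounds[OF uv(2) \<open>u \<le> v\<close> uv(3) near] by auto
        moreover have "(\<psi> x - e / 2) * (p v - p u) \<le> \<psi> c * (p v - p u)"
          "\<psi> c * (p v - p u) \<le> (\<psi> x + e / 2) * (p v - p u)"
          using near[OF c(1,2)] mono[OF uv(2) \<open>u \<le> v\<close> uv(3)] by (auto intro!: mult_right_mono)
        moreover have "(\<psi> x + e / 2) * (p v - p u) - (\<psi> x - e / 2) * (p v - p u) = e * (p v - p u)"
          by (simp add: algebra_simps)
        moreover have "\<lbrakk>d = r - y; lo \<le> r; r \<le> hi; lo \<le> y; y \<le> hi; hi - lo = z\<rbrakk> \<Longrightarrow> \<bar>d\<bar> \<le> z"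
          for d r y lo hi z :: real
          by linarith
        ultimately show "\<bar>D u v\<bar> \<le> e * (p v - p u)"
          by blast
      qed (fact d(1))
    qed
    then show ?thesis by (simp add: P_def)
  qed
  have "D a b = 0"
  proof (rule ccontr)
    assume "D a b \<noteq> 0"
    then have pos: "\<bar>D a b\<bar> > 0" by simp
    define \<delta> where "\<delta> = p b - p a"
    have "\<delta> > 0"
      using small[of 1] pos by (simp add: \<delta>_def)
    \<comment> \<open>This choice of \<open>e\<close> bounds \<open>\<bar>D a b\<bar>\<close> by
      half of itself.\<close>
    then show False
      using small[of "\<bar>D a b\<bar> / (2 * \<delta>)"] pos by (simp flip: \<delta>_def)
  qed
  then show ?thesis
    using int[of a b] \<open>a \<le> b\<close> unfolding D_def by (auto simp: has_integral_iff)
qed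

text \<open>The easy direction of Hake's theorem. Integrability over \<open>{..c}\<close> is tested
  on boxes containing a large ball; the box from \<open>a\<close> to \<open>max B c\<close> contains
  the ball once \<open>a \<le> - B\<close> and meets the half line in \<open>{a..c}\<close>.\<close>

lemma integral_half_line_tendsto:
  fixes h :: "real \<Rightarrow> real"
  assumes "h integrable_on {..c}"
  shows "((\<lambda>a. integral {a..c} h) \<longlongrightarrow> integral {..c} h) at_bot"
proof (rule tendstoI)
  fix e :: real assume "e > 0"
  have "(h has_integral integral {..c} h) {..c}"
    using assms by (rule integrable_integral)
  then obtain B where B: "B > 0" and *: "\<And>a b. ball 0 B \<subseteq> cbox a b \<Longrightarrow>
      norm (integral (cbox a b) (\<lambda>x. if x \<in> {..c} then h x else 0) - integral {..c} h) < e"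
    using \<open>e > 0\<close> unfolding has_integral_alt'[of h] by metis
  have "dist (integral {a..c} h) (integral {..c} h) < e" if "a \<le> - B" for a
  proof -
    have "integral (cbox a (max B c)) (\<lambda>x. if x \<in> {..c} then h x else 0)
        = integral ({..c} \<inter> cbox a (max B c)) h"
      by (rule Henstock_Kurzweil_Integration.integral_restrict_Int)
    also have "{..c} \<inter> cbox a (max B c) = {a..c}"
      by auto
    moreover have "ball 0 B \<subseteq> cbox a (max B c)"
      using that by (auto simp: dist_real_def)
    ultimately show ?thesis
      using *[of a "max B c"] by (simp add: dist_norm)
  qed
  then show "\<forall>\<^sub>F a in at_bot. dist (integral {a..c} h) (integral {..c} h) < e"
    unfolding eventually_at_bot_linorder by blast
qed

text \<open>Below \<open>K\<close>, \<open>H\<close> is a multiple of \<open>p\<close>; above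
  \<open>K\<close> it is an affine function minus a multiple of \<open>p\<close>. After integration
  by parts on both pieces the terms in \<open>\<psi> K\<close> match, and
  \<open>H \<Omega> = 0\<close> removes the one in \<open>\<psi> \<Omega>\<close>. Besides the
  claimed value there remains a term at the lower end \<open>a\<close>, which has to vanish in the
  limit although no growth bound on \<open>\<psi>\<close> is given.\<close>

lemma integral_transfer_kernel:
  fixes \<phi> \<psi> \<psi>' p r H :: "real \<Rightarrow> real"
  assumes "K < \<Omega>" "\<phi> \<Omega> = \<Omega>"
    and phi: "\<And>x. (\<phi> has_real_derivative \<psi> x) (at x)"
    and psi: "\<And>x. (\<psi> has_real_derivative \<psi>' x) (at x)"
    and psi_pos: "\<And>x. x < \<Omega> \<Longrightarrow> \<psi> x > 0"
    and mono: "\<And>x y. \<lbrakk>x \<le> y; y \<le> \<Omega>\<rbrakk> \<Longrightarrow> p x \<le> p y"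
    and nonneg: "\<And>x. x \<le> \<Omega> \<Longrightarrow> p x \<ge> 0" and "p \<Omega> > 0"
    and bounds: "\<And>u v lo hi. \<lbrakk>u \<le> v; v \<le> \<Omega>; \<And>x. \<lbrakk>u \<le> x; x \<le> v\<rbrakk> \<Longrightarrow> lo \<le> \<psi> x \<and> \<psi> x \<le> hi\<rbrakk>
      \<Longrightarrow> lo * (p v - p u) \<le> r v - r u \<and> r v - r u \<le> hi * (p v - p u)"
    and lim_p: "(p \<longlongrightarrow> 0) at_bot" and lim_r: "(r \<longlongrightarrow> 0) at_bot"
    and c: "c = p K + (\<Omega> - K) * d" "c > 0"
    and H: "\<And>x. x \<le> \<Omega> \<Longrightarrow> H x = (if x \<le> K then p x else p K + (x - K) * d) / c - p x / p \<Omega>"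
    and int: "(\<lambda>x. H x * \<psi>' x) integrable_on {..\<Omega>}"
  shows "integral {..\<Omega>} (\<lambda>x. H x * \<psi>' x) = r \<Omega> / p \<Omega> - (r K + (\<Omega> - \<phi> K) * d) / c"
proof -
  \<comment> \<open>\<open>\<kappa>\<close> is the factor of \<open>p\<close> in \<open>H\<close>
    below the barrier, and \<open>J\<close> is the value to be proved.\<close>
  define \<kappa> where "\<kappa> = 1 / c - 1 / p \<Omega>"
  define J where "J = r \<Omega> / p \<Omega> - (r K + (\<Omega> - \<phi> K) * d) / c"
  have parts: "((\<lambda>x. p x * \<psi>' x) has_integral (p b * \<psi> b - p a * \<psi> a - (r b - r a))) {a..b}"
    if "a \<le> b" "b \<le> \<Omega>" for a b
    by (rule has_integral_monotone_times_derivative[OF that(1) psi mono bounds])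
       (use that in auto)
  have "((\<lambda>x. (p K + (x - K) * d) * \<psi>' x) has_integral
      ((p K + (\<Omega> - K) * d) * \<psi> \<Omega> - d * \<phi> \<Omega>) - ((p K + (K - K) * d) * \<psi> K - d * \<phi> K)) {K..\<Omega>}"
  proof (rule fundamental_theorem_of_calculus)
    fix x
    have "((\<lambda>x. (p K + (x - K) * d) * \<psi> x - d * \<phi> x) has_real_derivative
        (p K + (x - K) * d) * \<psi>' x + (1 * d) * \<psi> x - d * \<psi> x) (at x within {K..\<Omega>})"
      by (rule derivative_eq_intros refl DERIV_subset[OF phi] DERIV_subset[OF psi] subset_UNIV)+ simp
    then show "((\<lambda>x. (p K + (x - K) * d) * \<psi> x - d * \<phi> x) has_vector_derivative
        (p K + (x - K) * d) * \<psi>' x) (at x within {K..\<Omega>})"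
      by (simp add: has_real_derivative_iff_has_vector_derivative)
  qed (use \<open>K < \<Omega>\<close> in simp)
  from has_integral_diff[OF has_integral_divide[OF this, of c]
      has_integral_divide[OF parts[of K \<Omega>], of "p \<Omega>"]]
  have "((\<lambda>x. (p K + (x - K) * d) * \<psi>' x / c - p x * \<psi>' x / p \<Omega>) has_integral
      (c * \<psi> \<Omega> - d * \<Omega> - (p K * \<psi> K - d * \<phi> K)) / c
      - (p \<Omega> * \<psi> \<Omega> - p K * \<psi> K - (r \<Omega> - r K)) / p \<Omega>) {K..\<Omega>}"
    using \<open>K < \<Omega>\<close> \<open>\<phi> \<Omega> = \<Omega>\<close> c by simp
  then have right: "((\<lambda>x. H x * \<psi>' x) has_integral
      (c * \<psi> \<Omega> - d * \<Omega> - (p K * \<psi> K - d * \<phi> K)) / c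
      - (p \<Omega> * \<psi> \<Omega> - p K * \<psi> K - (r \<Omega> - r K)) / p \<Omega>) {K..\<Omega>}"
    by (rule has_integral_eq[rotated]) (auto simp: H left_diff_distrib)
  have left: "((\<lambda>x. H x * \<psi>' x) has_integral
      \<kappa> * (p K * \<psi> K - p a * \<psi> a - (r K - r a))) {a..K}" if "a \<le> K" for a
  proof (rule has_integral_eq[rotated])
    show "((\<lambda>x. \<kappa> * (p x * \<psi>' x)) has_integral
      \<kappa> * (p K * \<psi> K - p a * \<psi> a - (r K - r a))) {a..K}"
      using that \<open>K < \<Omega>\<close> by (intro has_integral_mult_right parts) auto
    show "\<And>x. x \<in> {a..K} \<Longrightarrow> \<kappa> * (p x * \<psi>' x) = H x * \<psi>' x"
      using \<open>K < \<Omega>\<close> by (simp add: H \<kappa>_def algebra_simps)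
  qed
  have eq: "integral {a..\<Omega>} (\<lambda>x. H x * \<psi>' x) = J + \<kappa> * (r a - p a * \<psi> a)" if "a \<le> K" for a
  proof (rule integral_unique)
    have "\<kappa> * (p K * \<psi> K - p a * \<psi> a - (r K - r a)) +
      ((c * \<psi> \<Omega> - d * \<Omega> - (p K * \<psi> K - d * \<phi> K)) / c
      - (p \<Omega> * \<psi> \<Omega> - p K * \<psi> K - (r \<Omega> - r K)) / p \<Omega>) = J + \<kappa> * (r a - p a * \<psi> a)"
      using \<open>c > 0\<close> \<open>p \<Omega> > 0\<close> unfolding J_def \<kappa>_def
      by (simp add: diff_divide_distrib add_divide_distrib algebra_simps)
    then show "((\<lambda>x. H x * \<psi>' x) has_integral (J + \<kappa> * (r a - p a * \<psi> a))) {a..\<Omega>}"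
      using has_integral_combine[OF that _ left[OF that] right] \<open>K < \<Omega>\<close> by simp
  qed
  have ev: "\<forall>\<^sub>F a in at_bot. a \<le> K"
    by (rule eventually_le_at_bot)
  have lim: "((\<lambda>a. J + \<kappa> * (r a - p a * \<psi> a)) \<longlongrightarrow> integral {..\<Omega>} (\<lambda>x. H x * \<psi>' x)) at_bot"
    using integral_half_line_tendsto[OF int] eventually_mono[OF ev eq]
    by (rule Lim_transform_eventually)
  \<comment> \<open>Unless \<open>\<kappa> = 0\<close>, existence of the integral forces
    \<open>p a * \<psi> a\<close> to have a limit \<open>B\<close>, and decay of \<open>r\<close>
    excludes \<open>B > 0\<close>.\<close>
  have "((\<lambda>a. \<kappa> * (p a * \<psi> a)) \<longlongrightarrow> 0) at_bot"
  proof (cases "\<kappa> = 0")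
    case False
    define B where "B = (J - integral {..\<Omega>} (\<lambda>x. H x * \<psi>' x)) / \<kappa>"
    have "((\<lambda>a. (J + \<kappa> * r a - (J + \<kappa> * (r a - p a * \<psi> a))) / \<kappa>)
        \<longlongrightarrow> (J + \<kappa> * 0 - integral {..\<Omega>} (\<lambda>x. H x * \<psi>' x)) / \<kappa>) at_bot"
      by (intro tendsto_intros lim lim_r False)
    then have B: "((\<lambda>a. p a * \<psi> a) \<longlongrightarrow> B) at_bot"
      using False by (simp add: B_def algebra_simps)
    have "B = 0"
    proof (rule ccontr)
      assume "B \<noteq> 0"
      have "\<forall>\<^sub>F a in at_bot. 0 \<le> p a * \<psi> a"
        using ev by eventually_elim (use \<open>K < \<Omega>\<close> in \<open>auto intro!: mult_nonneg_nonneg nonneg less_imp_le[OF psi_pos]\<close>)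
      then have "B \<ge> 0"
        using B by (intro tendsto_lowerbound[OF B]) auto
      with \<open>B \<noteq> 0\<close> have "B > 0" by simp
      then have "\<forall>\<^sub>F a in at_bot. B / 2 < p a * \<psi> a" "\<forall>\<^sub>F a in at_bot. r a < B / 2"
        using order_tendstoD(1)[OF B, of "B/2"] order_tendstoD(2)[OF lim_r, of "B/2"] by auto
      then have "\<forall>\<^sub>F b in at_bot. B / 2 < p b * \<psi> b \<and> r b < B / 2 \<and> b \<le> K"
        using ev by eventually_elim auto
      then obtain b where b: "\<And>x. x \<le> b \<Longrightarrow> B / 2 < p x * \<psi> x \<and> r x < B / 2 \<and> x \<le> K"
        unfolding eventually_at_bot_linorder by blast
      have p_pos: "p x > 0" if "x \<le> b" for x
        using b[OF that] psi_pos[of x] nonneg[of x] \<open>K < \<Omega>\<close> \<open>B > 0\<close>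
        by (cases "p x = 0") auto
      \<comment> \<open>Below \<open>b\<close> the slope \<open>\<psi>\<close> is at least \<open>B / (2 p b)\<close>, so \<open>r b\<close> would be at least \<open>B / 2\<close>.\<close>
      have "B / (2 * p b) * (p b - p a) \<le> r b - r a" if "a \<le> b" for a
      proof -
        \<comment> \<open>\<open>bounds\<close> takes a two-sided estimate; the supremum, finite by
          compactness, supplies the upper side.\<close>
        have slope: "B / (2 * p b) \<le> \<psi> x \<and> \<psi> x \<le> Sup (\<psi> ` {a..b})" if x: "a \<le> x" "x \<le> b" for x
        proof
          have "B / 2 \<le> p x * \<psi> x" using b[OF x(2)] by simp
          also have "\<dots> \<le> p b * \<psi> x"
            using mono[of x b] b[OF x(2)] b[of b] psi_pos[of x] \<open>K < \<Omega>\<close> x(2)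
            by (intro mult_right_mono) auto
          finally show "B / (2 * p b) \<le> \<psi> x"
            using p_pos[of b] by (simp add: field_simps)
          have "continuous_on {a..b} \<psi>"
            using psi by (intro continuous_at_imp_continuous_on ballI DERIV_isCont)
          then have "bdd_above (\<psi> ` {a..b})"
            by (intro bounded_imp_bdd_above compact_imp_bounded compact_continuous_image) auto
          then show "\<psi> x \<le> Sup (\<psi> ` {a..b})"
            using x by (intro cSup_upper) auto
        qed
        have "b \<le> \<Omega>"
          using b[of b] \<open>K < \<Omega>\<close> by simp
        then show ?thesis
          using bounds[OF that _ slope] by blast
      qed
      then have "\<forall>\<^sub>F a in at_bot. B / (2 * p b) * (p b - p a) \<le> r b - r a"
        unfolding eventually_at_bot_linorder by blast
      moreover have "((\<lambda>a. B / (2 * p b) * (p b - p a)) \<longlongrightarrow> B / (2 * p b) * (p b - 0)) at_bot"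
        "((\<lambda>a. r b - r a) \<longlongrightarrow> r b - 0) at_bot"
        by (intro tendsto_intros lim_p lim_r)+
      ultimately have "B / (2 * p b) * (p b - 0) \<le> r b - 0"
        by (intro tendsto_le[of at_bot]) auto
      then show False
        using b[of b] p_pos[of b] by simp
    qed
    then show ?thesis
      using tendsto_mult_right[OF B, of \<kappa>] by (simp add: mult.commute)
  qed simp
  then have "((\<lambda>a. J + (\<kappa> * r a - \<kappa> * (p a * \<psi> a))) \<longlongrightarrow> J + (\<kappa> * 0 - 0)) at_bot"
    by (intro tendsto_intros lim_r)
  then have "((\<lambda>a. J + \<kappa> * (r a - p a * \<psi> a)) \<longlongrightarrow> J) at_bot"
    by (simp add: algebra_simps)
  with lim have "integral {..\<Omega>} (\<lambda>x. H x * \<psi>' x) = J"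
    by (intro tendsto_unique[OF _ lim]) auto
  then show ?thesis by (simp add: J_def)
qed

subsection \<open>Put prices and shortfalls of a family of densities\<close>

lemma set_integral_nonneg_real:
  fixes f :: "'a \<Rightarrow> real"
  assumes "\<And>x. x \<in> A \<Longrightarrow> 0 \<le> f x"
  shows "0 \<le> (LINT x:A|M. f x)"
  unfolding set_lebesgue_integral_def
  by (rule Bochner_Integration.integral_nonneg) (auto simp: assms split: split_indicator)

text \<open>\<open>X\<close> and \<open>Y\<close> each give an instance, with the same
  \<open>\<Omega>\<close> because \<open>\<phi>\<close> fixes it.\<close>

locale density_family =
  fixes \<Omega> :: real and I :: "real set" and f :: "real \<Rightarrow> real \<Rightarrow> real"
  assumes measurable: "m \<in> I \<Longrightarrow> f m \<in> borel_measurable borel"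
    and nonneg: "m \<in> I \<Longrightarrow> 0 \<le> f m x"
    and integrable: "m \<in> I \<Longrightarrow> integrable lborel (f m)"
    and moment: "m \<in> I \<Longrightarrow> set_integrable lborel {..\<Omega>} (\<lambda>x. (\<Omega> - x) * f m x)"
begin

lemma set_integrable:
  assumes "m \<in> I" "A \<in> sets borel"
  shows "set_integrable lborel A (f m)"
  using assms integrable by (auto simp: set_integrable_def simp del: real_scaleR_def intro!: integrable_mult_indicator)

lemma dist_fun_nonneg: "m \<in> I \<Longrightarrow> 0 \<le> dist_fun f m x"
  unfolding dist_fun_def by (rule set_integral_nonneg_real) (simp add: nonneg)

lemma dist_fun_split:
  assumes "m \<in> I" "a \<le> x"
  shows "dist_fun f m x = dist_fun f m a + integral {a..x} (f m)"
proof -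
  have "(LINT t:{..a} \<union> {a..x}|lborel. f m t) = dist_fun f m a + (LINT t:{a..x}|lborel. f m t)"
    unfolding dist_fun_def
  proof (rule set_integral_Un_AE)
    show "AE t in lborel. \<not> (t \<in> {..a} \<and> t \<in> {a..x})"
      using AE_lborel_singleton[of a] by eventually_elim auto
  qed (auto intro!: set_integrable assms)
  moreover have "{..a} \<union> {a..x} = {..x}" using assms by auto
  ultimately show ?thesis
    using set_borel_integral_eq_integral(2)[OF set_integrable[OF \<open>m \<in> I\<close>, of "{a..x}"]]
    by (simp add: dist_fun_def)
qed

lemma isCont_dist_fun:
  assumes "m \<in> I"
  shows "isCont (dist_fun f m) x"
proof -
  have "f m integrable_on {x - 1..x + 1}"
    using set_borel_integral_eq_integral(1)[OF set_integrable[OF assms]] by simp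
  then have "continuous_on {x - 1..x + 1} (\<lambda>y. dist_fun f m (x - 1) + integral {x - 1..y} (f m))"
    by (intro continuous_intros indefinite_integral_continuous_1)
  then have "continuous_on {x - 1..x + 1} (dist_fun f m)"
    by (rule continuous_on_eq) (rule dist_fun_split[OF assms, symmetric], simp)
  then show ?thesis
    by (rule continuous_on_interior) auto
qed

lemma continuous_on_dist_fun: "m \<in> I \<Longrightarrow> continuous_on A (dist_fun f m)"
  by (intro continuous_at_imp_continuous_on ballI isCont_dist_fun)

lemma dist_fun_measurable: "m \<in> I \<Longrightarrow> dist_fun f m \<in> borel_measurable borel"
  by (intro borel_measurable_continuous_onI continuous_on_dist_fun)

lemma moment_le:
  assumes "m \<in> I" "x \<le> \<Omega>"
  shows "set_integrable lborel {..x} (\<lambda>t. (x - t) * f m t)"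
proof -
  have "set_integrable lborel {..x} (\<lambda>t. (\<Omega> - t) * f m t - (\<Omega> - x) * f m t)"
    using assms moment[OF assms(1)] set_integrable[OF assms(1), of "{..x}"]
    by (intro set_integral_diff set_integrable_mult_right)
       (auto intro: set_integrable_subset[of _ "{..\<Omega>}"])
  then show ?thesis
    by (simp add: algebra_simps)
qed

text \<open>Tonelli on the triangle \<open>u \<le> t \<le> x\<close>. In nonnegative integrals the
  identity can precede any integrability of the distribution function.\<close>

lemma nn_integral_dist_fun:
  assumes m: "m \<in> I"
  shows "(\<integral>\<^sup>+t. ennreal (dist_fun f m t) * indicator {..x} t \<partial>lborel)
    = (\<integral>\<^sup>+u. ennreal ((x - u) * f m u) * indicator {..x} u \<partial>lborel)"
proof -
  note [measurable] = measurable[OF m]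
  have F: "ennreal (dist_fun f m t) = (\<integral>\<^sup>+u. ennreal (f m u) * indicator {..t} u \<partial>lborel)" for t
  proof -
    have "(\<integral>\<^sup>+u. ennreal (f m u) * indicator {..t} u \<partial>lborel)
        = (\<integral>\<^sup>+u. ennreal (indicator {..t} u *\<^sub>R f m u) \<partial>lborel)"
      by (intro nn_integral_cong) (auto split: split_indicator)
    also have "\<dots> = ennreal (dist_fun f m t)"
      unfolding dist_fun_def set_lebesgue_integral_def
      using set_integrable[OF m, of "{..t}"]
      by (intro nn_integral_eq_integral) (auto simp: set_integrable_def nonneg m)
    finally show ?thesis by simp
  qed
  have "(\<integral>\<^sup>+t. ennreal (dist_fun f m t) * indicator {..x} t \<partial>lborel)
      = (\<integral>\<^sup>+t. (\<integral>\<^sup>+u. ennreal (f m u) * (indicator {..x} t * indicator {..t} u) \<partial>lborel) \<partial>lborel)"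
    unfolding F by (intro nn_integral_cong) (auto simp: split: split_indicator)
  also have "\<dots> = (\<integral>\<^sup>+t. (\<integral>\<^sup>+u. ennreal (f m u) * (if u \<le> t \<and> t \<le> x then 1 else 0) \<partial>lborel) \<partial>lborel)"
    by (intro nn_integral_cong) (auto split: split_indicator)
  also have "\<dots> = (\<integral>\<^sup>+u. (\<integral>\<^sup>+t. ennreal (f m u) * (if u \<le> t \<and> t \<le> x then 1 else 0) \<partial>lborel) \<partial>lborel)"
    by (rule lborel_pair.Fubini') measurable
  also have "\<dots> = (\<integral>\<^sup>+u. (\<integral>\<^sup>+t. ennreal (f m u) * indicator {u..x} t \<partial>lborel) \<partial>lborel)"
    by (intro nn_integral_cong) (auto split: split_indicator)
  also have "\<dots> = (\<integral>\<^sup>+u. ennreal ((x - u) * f m u) * indicator {..x} u \<partial>lborel)"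
  proof (intro nn_integral_cong)
    fix u
    have "(\<integral>\<^sup>+t. ennreal (f m u) * indicator {u..x} t \<partial>lborel) = ennreal (f m u) * emeasure lborel {u..x}"
      by (rule nn_integral_cmult_indicator) simp
    also have "\<dots> = ennreal ((x - u) * f m u) * indicator {..x} u"
    proof (cases "u \<le> x")
      case True
      then show ?thesis by (simp add: ennreal_mult' nonneg m mult.commute)
    qed simp
    finally show "(\<integral>\<^sup>+t. ennreal (f m u) * indicator {u..x} t \<partial>lborel)
      = ennreal ((x - u) * f m u) * indicator {..x} u" .
  qed
  finally show ?thesis .
qed

text \<open>Finiteness in the Tonelli identity gives integrability of the distribution function; the
  value gives the expected payoff of the put.\<close>

lemma
  assumes m: "m \<in> I" and x: "x \<le> \<Omega>"
  shows set_integrable_dist_fun_le: "set_integrable lborel {..x} (dist_fun f m)"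
    and put_price_eq: "put_price f m x = (LINT t:{..x}|lborel. (x - t) * f m t)"
proof -
  note [measurable] = measurable[OF m] dist_fun_measurable[OF m]
  let ?M = "LINT t:{..x}|lborel. (x - t) * f m t"
  have nn: "(\<integral>\<^sup>+t. ennreal (indicator {..x} t *\<^sub>R dist_fun f m t) \<partial>lborel) = ennreal ?M"
  proof -
    have "(\<integral>\<^sup>+t. ennreal (indicator {..x} t *\<^sub>R dist_fun f m t) \<partial>lborel)
        = (\<integral>\<^sup>+t. ennreal (dist_fun f m t) * indicator {..x} t \<partial>lborel)"
      by (intro nn_integral_cong) (auto split: split_indicator)
    also have "\<dots> = (\<integral>\<^sup>+u. ennreal ((x - u) * f m u) * indicator {..x} u \<partial>lborel)"
      by (rule nn_integral_dist_fun[OF m])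
    also have "\<dots> = (\<integral>\<^sup>+u. ennreal (indicator {..x} u *\<^sub>R ((x - u) * f m u)) \<partial>lborel)"
      by (intro nn_integral_cong) (auto split: split_indicator)
    also have "\<dots> = ennreal ?M"
      unfolding set_lebesgue_integral_def using moment_le[OF m x]
      by (intro nn_integral_eq_integral)
         (auto simp: set_integrable_def nonneg m split: split_indicator)
    finally show ?thesis .
  qed
  have "?M \<ge> 0"
    by (rule set_integral_nonneg_real) (simp add: nonneg m)
  have pos: "0 \<le> indicator {..x} t *\<^sub>R dist_fun f m t" for t
    by (simp add: dist_fun_nonneg m)
  have "integrable lborel (\<lambda>t. indicator {..x} t *\<^sub>R dist_fun f m t)"
    by (rule integrableI_nn_integral_finite[OF _ _ nn]) (use pos in auto)
  then show "set_integrable lborel {..x} (dist_fun f m)"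
    by (simp add: set_integrable_def)
  show "put_price f m x = ?M"
    unfolding put_price_def set_lebesgue_integral_def[of _ _ "dist_fun f m"]
    using nn pos \<open>?M \<ge> 0\<close> by (subst integral_eq_nn_integral) auto
qed

lemma set_integrable_dist_fun:
  assumes "m \<in> I"
  shows "set_integrable lborel {..x} (dist_fun f m)"
proof -
  have "set_integrable lborel ({..\<Omega>} \<union> {\<Omega>..x}) (dist_fun f m)"
    using assms by (intro set_integrable_Un set_integrable_dist_fun_le
      borel_integrable_compact[unfolded set_integrable_def[symmetric]] continuous_on_dist_fun) auto
  then show ?thesis
    by (rule set_integrable_subset) auto
qed

lemma put_price_split:
  assumes "m \<in> I" "a \<le> x"
  shows "put_price f m x = put_price f m a + integral {a..x} (dist_fun f m)"
proof -
  have int: "set_integrable lborel {a..x} (dist_fun f m)"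
    using set_integrable_dist_fun[OF assms(1), of x] by (rule set_integrable_subset) auto
  have "(LINT t:{..a} \<union> {a..x}|lborel. dist_fun f m t)
      = put_price f m a + (LINT t:{a..x}|lborel. dist_fun f m t)"
    unfolding put_price_def
  proof (rule set_integral_Un_AE)
    show "AE t in lborel. \<not> (t \<in> {..a} \<and> t \<in> {a..x})"
      using AE_lborel_singleton[of a] by eventually_elim auto
  qed (use int in \<open>auto intro!: set_integrable_dist_fun assms\<close>)
  moreover have "{..a} \<union> {a..x} = {..x}" using assms by auto
  ultimately show ?thesis
    using set_borel_integral_eq_integral(2)[OF int] by (simp add: put_price_def)
qed

lemma has_real_derivative_put_price:
  assumes "m \<in> I"
  shows "(put_price f m has_real_derivative dist_fun f m x) (at x)"
proof -
  have "((\<lambda>y. put_price f m (x - 1) + integral {x - 1..y} (dist_fun f m))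
      has_real_derivative 0 + dist_fun f m x) (at x within {x - 1..x + 1})"
    using assms by (intro derivative_intros integral_has_real_derivative continuous_on_dist_fun) auto
  then have "((\<lambda>y. put_price f m (x - 1) + integral {x - 1..y} (dist_fun f m))
      has_real_derivative dist_fun f m x) (at x)"
    by (simp add: at_within_Icc_at)
  then show ?thesis
    by (rule has_field_derivative_transform_within_open[of _ _ _ "{x - 1<..}"])
       (auto intro!: put_price_split[OF assms, symmetric])
qed

lemma shortfall_integral_eq:
  assumes "m \<in> I" "x \<le> \<Omega>"
  shows "(LINT t:{..x}|lborel. (\<Omega> - t) * f m t) = (\<Omega> - x) * dist_fun f m x + put_price f m x"
proof -
  have "(LINT t:{..x}|lborel. (\<Omega> - t) * f m t)
      = (LINT t:{..x}|lborel. (\<Omega> - x) * f m t + (x - t) * f m t)"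
    by (simp add: algebra_simps)
  also have "\<dots> = (LINT t:{..x}|lborel. (\<Omega> - x) * f m t) + (LINT t:{..x}|lborel. (x - t) * f m t)"
    using assms set_integrable[OF assms(1), of "{..x}"]
    by (intro set_integral_add moment_le set_integrable_mult_right) auto
  finally show ?thesis
    using assms by (simp add: put_price_eq dist_fun_def)
qed

lemma semi_deviation_eq_put_price: "m \<in> I \<Longrightarrow> semi_deviation \<Omega> f m = put_price f m \<Omega>"
  using shortfall_integral_eq[of m \<Omega>] by (simp add: semi_deviation_def)

text \<open>The order in the parameter is available only strictly below \<open>\<Omega>\<close>;
  continuity carries it to the end point.\<close>

lemma dist_fun_le_left_limit:
  assumes m: "m \<in> I" "n \<in> I" and le: "\<And>t. t < y \<Longrightarrow> dist_fun f m t \<le> dist_fun f n t"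
  shows "dist_fun f m y \<le> dist_fun f n y"
proof (rule tendsto_le)
  show "(dist_fun f m \<longlongrightarrow> dist_fun f m y) (at_left y)" "(dist_fun f n \<longlongrightarrow> dist_fun f n y) (at_left y)"
    using isCont_dist_fun[OF m(1), of y] isCont_dist_fun[OF m(2), of y]
    by (auto simp: isCont_def intro: tendsto_within_subset)
  show "\<forall>\<^sub>F t in at_left y. dist_fun f m t \<le> dist_fun f n t"
    unfolding eventually_at_filter by (rule always_eventually) (simp add: le)
qed simp

text \<open>From strike \<open>x\<close> to strike \<open>y\<close> the price difference gains the
  integral of the difference of the distribution functions. Monotonicity in the strike of the
  parameter derivatives comes from here.\<close>

lemma put_price_diff_mono:
  assumes m: "m \<in> I" "n \<in> I" "x \<le> y"
    and le: "\<And>t. t < y \<Longrightarrow> dist_fun f m t \<le> dist_fun f n t"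
  shows "put_price f n x - put_price f m x \<le> put_price f n y - put_price f m y"
proof -
  have "integral {x..y} (dist_fun f m) \<le> integral {x..y} (dist_fun f n)"
  proof (rule integral_le)
    fix t assume "t \<in> {x..y}"
    then show "dist_fun f m t \<le> dist_fun f n t"
      using le dist_fun_le_left_limit[OF m(1,2) le] by (cases "t = y") simp_all
  qed (use m in \<open>simp_all add: integrable_continuous_real continuous_on_dist_fun\<close>)
  then show ?thesis
    using put_price_split[OF m(1,3)] put_price_split[OF m(2,3)] by linarith
qed

lemma put_price_mono:
  assumes "m \<in> I" "n \<in> I" and le: "\<And>t. t < x \<Longrightarrow> dist_fun f m t \<le> dist_fun f n t"
  shows "put_price f m x \<le> put_price f n x"
proof -
  have "AE t in lborel. t \<in> {..x} \<longrightarrow> dist_fun f m t \<le> dist_fun f n t"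
    using AE_lborel_singleton[of x] by eventually_elim (use le in auto)
  then show ?thesis
    unfolding put_price_def using assms
    by (intro set_integral_mono_AE set_integrable_dist_fun) auto
qed

text \<open>Beyond \<open>K\<close> the capped distribution function is constant, so the barrier
  price continues along the tangent of the put price at \<open>K\<close>.\<close>

lemma barrier_put_price_above:
  assumes "m \<in> I" "K \<le> x"
  shows "barrier_put_price f K m x = put_price f m K + (x - K) * dist_fun f m K"
proof -
  have cong: "set_integrable lborel {..K} (capped_dist_fun f K m)"
    using set_integrable_dist_fun[OF assms(1), of K]
    by (rule set_integrable_cong[THEN iffD1, rotated -1]) (auto simp: capped_dist_fun_def)
  have const: "set_integrable lborel {K..x} (capped_dist_fun f K m)"
    "(LINT t:{K..x}|lborel. capped_dist_fun f K m t) = (x - K) * dist_fun f m K"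
  proof -
    have "set_integrable lborel {K..x} (\<lambda>t. dist_fun f m K)"
      unfolding set_integrable_def by (intro borel_integrable_compact) auto
    then show "set_integrable lborel {K..x} (capped_dist_fun f K m)"
      by (rule set_integrable_cong[THEN iffD1, rotated -1]) (auto simp: capped_dist_fun_def)
    have "(LINT t:{K..x}|lborel. capped_dist_fun f K m t) = (LINT t:{K..x}|lborel. dist_fun f m K)"
      by (rule set_lebesgue_integral_cong) (auto simp: capped_dist_fun_def)
    then show "(LINT t:{K..x}|lborel. capped_dist_fun f K m t) = (x - K) * dist_fun f m K"
      using assms(2) by (simp add: set_lebesgue_integral_def)
  qed
  have "(LINT t:{..K} \<union> {K..x}|lborel. capped_dist_fun f K m t)
      = (LINT t:{..K}|lborel. capped_dist_fun f K m t) + (LINT t:{K..x}|lborel. capped_dist_fun f K m t)"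
  proof (rule set_integral_Un_AE)
    show "AE t in lborel. \<not> (t \<in> {..K} \<and> t \<in> {K..x})"
      using AE_lborel_singleton[of K] by eventually_elim auto
  qed (use const cong in auto)
  moreover have "{..K} \<union> {K..x} = {..x}" using assms by auto
  moreover have "(LINT t:{..K}|lborel. capped_dist_fun f K m t) = put_price f m K"
    unfolding put_price_def by (rule set_lebesgue_integral_cong) (auto simp: capped_dist_fun_def)
  ultimately show ?thesis
    using const(2) by (simp add: barrier_put_price_def)
qed

lemma barrier_put_price_below: "x \<le> K \<Longrightarrow> barrier_put_price f K m x = put_price f m x"
  unfolding barrier_put_price_def put_price_def
  by (rule set_lebesgue_integral_cong) (auto simp: capped_dist_fun_def min_def)

end

subsection \<open>Sensitivity to the parameter\<close>

text \<open>Turns comparisons between \<open>l\<close> and parameters \<open>m > l\<close> into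
  inequalities between derivatives at \<open>l\<close>, with no derivative taken under an
  integral.\<close>

lemma DERIV_nonneg_of_le_right:
  fixes h :: "real \<Rightarrow> real"
  assumes "(h has_real_derivative D) (at l)" and "\<forall>\<^sub>F m in at_right l. h l \<le> h m"
  shows "0 \<le> D"
proof (rule tendsto_lowerbound)
  have "((\<lambda>m. (h m - h l) / (m - l)) \<longlongrightarrow> D) (at l)"
    using assms(1) by (simp add: has_field_derivative_iff)
  then show "((\<lambda>m. (h m - h l) / (m - l)) \<longlongrightarrow> D) (at_right l)"
    by (rule tendsto_within_subset) simp
  show "\<forall>\<^sub>F m in at_right l. 0 \<le> (h m - h l) / (m - l)"
    using assms(2) eventually_at_right_less[of l] by eventually_elim simp
qed simp

text \<open>Chosen weak enough to hold for \<open>Y\<close> too: left of the range of \<phi> the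
  distribution function of \<open>Y\<close> is 0 for every parameter, so \<open>mono\<close> is not
  strict and \<open>sensitive\<close> speaks of a single level.\<close>

locale fragile_family = density_family +
  fixes l :: real
  assumes interior: "l \<in> interior I"
    and well_defined: "fragility_well_defined \<Omega> I f l"
    and inj: "inj_on (semi_deviation \<Omega> f) I"
    and mono: "\<lbrakk>m \<in> I; n \<in> I; m \<le> n; t < \<Omega>\<rbrakk> \<Longrightarrow> dist_fun f m t \<le> dist_fun f n t"
    and sensitive: "\<exists>K<\<Omega>. \<exists>D>0. ((\<lambda>m. dist_fun f m K) has_real_derivative D) (at l)"
begin

text \<open>The numerator of the fragility.\<close>

definition shortfall_sensitivity :: "real \<Rightarrow> real" where
  "shortfall_sensitivity K = (LINT x:{..K}|lborel. (\<Omega> - x) * deriv (\<lambda>m. f m x) l)"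

lemma param_mem: "l \<in> I"
  using interior interior_subset by blast

lemma eventually_mem: "\<forall>\<^sub>F m in at_right l. m \<in> I \<and> l \<le> m"
proof -
  have "\<forall>\<^sub>F m in at_right l. m \<in> interior I"
    using interior by (intro eventually_at_topological[THEN iffD2]) (auto intro: exI[of _ "interior I"])
  then show ?thesis
    using eventually_at_right_less[of l] by eventually_elim (use interior_subset[of I] in auto)
qed

lemma shortfall_semi_deviation:
  "m \<in> I \<Longrightarrow> shortfall \<Omega> I f K (semi_deviation \<Omega> f m) = (LINT x:{..K}|lborel. (\<Omega> - x) * f m x)"
  by (simp add: shortfall_def param_of_deviation_def inj)

lemma DERIV_cong_params:
  assumes "(h has_real_derivative D) (at l)" "\<And>m. m \<in> I \<Longrightarrow> h m = k m"
  shows "(k has_real_derivative D) (at l)"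
  using assms(1) open_interior interior
  by (rule has_field_derivative_transform_within_open) (use assms(2) interior_subset[of I] in auto)

lemma has_real_derivative_semi_deviation:
  "(semi_deviation \<Omega> f has_real_derivative deriv (semi_deviation \<Omega> f) l) (at l)"
  using well_defined unfolding fragility_well_defined_def
  by (metis DERIV_deriv_iff_real_differentiable)

lemma has_real_derivative_shortfall:
  assumes "K < \<Omega>"
  shows "(shortfall \<Omega> I f K has_real_derivative shortfall_sensitivity K / deriv (semi_deviation \<Omega> f) l)
    (at (semi_deviation \<Omega> f l))"
  using well_defined assms unfolding fragility_well_defined_def shortfall_sensitivity_def by blast

lemma fragility_eq:
  "K < \<Omega> \<Longrightarrow> fragility \<Omega> I f K (semi_deviation \<Omega> f l)
    = shortfall_sensitivity K / deriv (semi_deviation \<Omega> f) l"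
  unfolding fragility_def by (rule DERIV_imp_deriv) (rule has_real_derivative_shortfall)

text \<open>The put price is the shortfall, composed with the semi-deviation, minus
  \<open>(\<Omega> - K) * dist_fun f m K\<close>; the chain rule does the rest. The factor
  \<open>s'\<close> stays uncancelled because \<open>s' \<noteq> 0\<close> is itself derived from
  this lemma.\<close>

lemma has_real_derivative_put_price_aux:
  assumes "K < \<Omega>" "((\<lambda>m. dist_fun f m K) has_real_derivative D) (at l)"
  defines "s' \<equiv> deriv (semi_deviation \<Omega> f) l"
  shows "((\<lambda>m. put_price f m K) has_real_derivative
    shortfall_sensitivity K / s' * s' - (\<Omega> - K) * D) (at l)"
proof (rule DERIV_cong_params)
  show "((\<lambda>m. shortfall \<Omega> I f K (semi_deviation \<Omega> f m) - (\<Omega> - K) * dist_fun f m K)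
      has_real_derivative shortfall_sensitivity K / s' * s' - (\<Omega> - K) * D) (at l)"
    unfolding s'_def
    by (intro DERIV_diff DERIV_cmult assms(2)
      DERIV_chain2[OF has_real_derivative_shortfall[OF assms(1)] has_real_derivative_semi_deviation])
next
  fix m assume "m \<in> I"
  then show "shortfall \<Omega> I f K (semi_deviation \<Omega> f m) - (\<Omega> - K) * dist_fun f m K = put_price f m K"
    using assms(1) by (simp add: shortfall_semi_deviation shortfall_integral_eq)
qed

lemma put_price_deriv_nonneg:
  assumes "x \<le> \<Omega>" "((\<lambda>m. put_price f m x) has_real_derivative D) (at l)"
  shows "0 \<le> D"
proof (rule DERIV_nonneg_of_le_right[OF assms(2)])
  show "\<forall>\<^sub>F m in at_right l. put_price f l x \<le> put_price f m x"
    using eventually_mem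
    by eventually_elim (use assms(1) param_mem in \<open>auto intro!: put_price_mono mono\<close>)
qed

lemma put_price_deriv_mono:
  assumes "x \<le> y" "y \<le> \<Omega>"
    and "((\<lambda>m. put_price f m x) has_real_derivative D) (at l)"
    and "((\<lambda>m. put_price f m y) has_real_derivative E) (at l)"
  shows "D \<le> E"
proof -
  have "0 \<le> E - D"
  proof (rule DERIV_nonneg_of_le_right[OF DERIV_diff[OF assms(4,3)]])
    show "\<forall>\<^sub>F m in at_right l. put_price f l y - put_price f l x \<le> put_price f m y - put_price f m x"
      using eventually_mem
    proof eventually_elim
      case (elim m)
      have "put_price f m x - put_price f l x \<le> put_price f m y - put_price f l y"
        using elim assms(1,2) param_mem by (intro put_price_diff_mono) (auto intro: mono)
      then show ?case by simp
    qed
  qed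
  then show ?thesis by simp
qed

lemma has_real_derivative_put_price_end:
  "((\<lambda>m. put_price f m \<Omega>) has_real_derivative deriv (semi_deviation \<Omega> f) l) (at l)"
  by (rule DERIV_cong_params[OF has_real_derivative_semi_deviation]) (rule semi_deviation_eq_put_price)

lemma semi_deviation_deriv_pos: "0 < deriv (semi_deviation \<Omega> f) l"
proof -
  \<comment> \<open>If the derivative vanished, then by the chain rule so would that of every shortfall
    \<open>(\<Omega> - K) F K + P K\<close>, although \<open>P\<close> is monotone and \<open>F\<close> has positive derivative at some \<open>K\<close>.\<close>
  obtain K D where K: "K < \<Omega>" "D > 0" "((\<lambda>m. dist_fun f m K) has_real_derivative D) (at l)"
    using sensitive by blast
  have "deriv (semi_deviation \<Omega> f) l \<noteq> 0"
  proof
    assume "deriv (semi_deviation \<Omega> f) l = 0"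
    then have "((\<lambda>m. put_price f m K) has_real_derivative - ((\<Omega> - K) * D)) (at l)"
      using has_real_derivative_put_price_aux[OF K(1,3)] by simp
    then have "0 \<le> - ((\<Omega> - K) * D)"
      using K(1) by (intro put_price_deriv_nonneg[of K]) auto
    then show False using K by (simp add: mult_le_0_iff)
  qed
  moreover have "0 \<le> deriv (semi_deviation \<Omega> f) l"
    by (rule put_price_deriv_nonneg[OF order_refl has_real_derivative_put_price_end])
  ultimately show ?thesis by simp
qed

lemma has_real_derivative_put_price_param:
  assumes "K < \<Omega>" "((\<lambda>m. dist_fun f m K) has_real_derivative D) (at l)"
  shows "((\<lambda>m. put_price f m K) has_real_derivative shortfall_sensitivity K - (\<Omega> - K) * D) (at l)"
  using has_real_derivative_put_price_aux[OF assms] semi_deviation_deriv_pos by simp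

text \<open>The densities vanish left of \<open>\<beta>\<close> only almost everywhere, with a null
  set that depends on the parameter, so the integrand is not evaluated directly. Distribution
  function and put price at \<open>\<beta>\<close> are 0 for all parameters in \<open>I\<close>, and
  the sensitivity is a combination of their derivatives.\<close>

lemma shortfall_sensitivity_null:
  assumes \<beta>: "\<beta> < \<Omega>" and null: "\<And>m. m \<in> I \<Longrightarrow> dist_fun f m \<beta> = 0"
  shows "shortfall_sensitivity \<beta> = 0"
proof -
  have F0: "dist_fun f m t = 0" if "m \<in> I" "t \<le> \<beta>" for m t
  proof -
    have "0 \<le> integral {t..\<beta>} (f m)"
      by (rule Henstock_Kurzweil_Integration.integral_nonneg)
         (use that nonneg set_borel_integral_eq_integral(1)[OF set_integrable[of m "{t..\<beta>}"]] in auto)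
    then show ?thesis
      using dist_fun_split[OF that] null[OF that(1)] dist_fun_nonneg[OF that(1), of t] by linarith
  qed
  have "(LINT t:{..\<beta>}|lborel. dist_fun f m t) = (LINT t:{..\<beta>}|lborel. 0)" if "m \<in> I" for m
    by (rule set_lebesgue_integral_cong) (use F0 that in auto)
  then have P0: "put_price f m \<beta> = 0" if "m \<in> I" for m
    using that by (simp add: put_price_def set_lebesgue_integral_def)
  have zero: "((\<lambda>_. 0) has_real_derivative 0) (at l)"
    by (rule DERIV_const)
  have "((\<lambda>m. dist_fun f m \<beta>) has_real_derivative 0) (at l)"
    "((\<lambda>m. put_price f m \<beta>) has_real_derivative 0) (at l)"
    by (rule DERIV_cong_params[OF zero], simp add: null P0)+
  then show ?thesis
    using has_real_derivative_put_price_param[OF \<beta>] by (metis DERIV_unique diff_0_right mult_zero_right)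
qed

text \<open>Continuity of the integral along shrinking half lines. The levels are images under
  \<open>\<phi>\<close> so that the lemma serves \<open>Y\<close>, and also \<open>X\<close> with
  the identity as \<open>\<phi>\<close>.\<close>

lemma shortfall_sensitivity_tendsto_0:
  fixes \<phi> :: "real \<Rightarrow> real"
  assumes phi: "strict_mono \<phi>" "\<phi> \<Omega> = \<Omega>"
    and null: "\<And>m y. \<lbrakk>m \<in> I; \<And>x. y < \<phi> x\<rbrakk> \<Longrightarrow> dist_fun f m y = 0"
  shows "(\<lambda>n. shortfall_sensitivity (\<phi> (\<Omega> - 1 - real n))) \<longlonglongrightarrow> 0"
proof -
  define a where "a n = \<phi> (\<Omega> - 1 - real n)" for n
  have less: "a n < \<Omega>" for n
    using strict_monoD[OF phi(1), of "\<Omega> - 1 - real n" \<Omega>] phi(2) by (simp add: a_def)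
  have decr: "a n \<le> a m" if "m \<le> n" for m n
    using that strict_mono_less_eq[OF phi(1)] by (simp add: a_def)
  have below: "\<exists>n. a n < \<phi> x" for x
  proof -
    obtain n where "\<Omega> - x < real n" using reals_Archimedean2 by blast
    then show ?thesis
      using strict_monoD[OF phi(1), of "\<Omega> - 1 - real n" x] by (auto simp: a_def)
  qed
  have "(\<lambda>n. shortfall_sensitivity (a n)) \<longlonglongrightarrow>
      (LINT x:(\<Inter>n. {..a n})|lborel. (\<Omega> - x) * deriv (\<lambda>m. f m x) l)"
    unfolding shortfall_sensitivity_def
  proof (rule set_integral_cont_down)
    show "decseq (\<lambda>n. {..a n})"
      using decr by (auto simp: decseq_def intro: order_trans)
    show "set_integrable lborel {..a 0} (\<lambda>x. (\<Omega> - x) * deriv (\<lambda>m. f m x) l)"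
      using well_defined less[of 0] unfolding fragility_well_defined_def by blast
  qed simp
  moreover have "(LINT x:(\<Inter>n. {..a n})|lborel. (\<Omega> - x) * deriv (\<lambda>m. f m x) l) = 0"
  proof (cases "(\<Inter>n. {..a n}) = {}")
    \<comment> \<open>If \<open>\<phi>\<close> is bounded below by \<open>\<beta>\<close>, no mass lies to the left of \<open>\<beta>\<close> for any parameter.\<close>
    case False
    then obtain y where y: "\<And>n. y \<le> a n" by auto
    define \<beta> where "\<beta> = (INF n. a n)"
    have bdd: "bdd_below (range a)"
      using y by (auto intro!: bdd_belowI[of _ y])
    have \<beta>_le: "\<beta> \<le> a n" for n
      unfolding \<beta>_def by (rule cINF_lower[OF bdd]) simp
    have "(\<Inter>n. {..a n}) = {..\<beta>}"
      using \<beta>_le by (auto simp: \<beta>_def intro!: cINF_greatest intro: order_trans)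
    moreover have "shortfall_sensitivity \<beta> = 0"
    proof (rule shortfall_sensitivity_null)
      show "\<beta> < \<Omega>" using \<beta>_le[of 0] less[of 0] by simp
      show "dist_fun f m \<beta> = 0" if "m \<in> I" for m
        using that
      proof (rule null)
        fix x
        show "\<beta> < \<phi> x" using below[of x] \<beta>_le by (meson le_less_trans)
      qed
    qed
    ultimately show ?thesis by (simp add: shortfall_sensitivity_def)
  qed (simp add: set_lebesgue_integral_def)
  ultimately show ?thesis by (simp add: a_def)
qed

end

text \<open>Reading a distribution function as the probability of an event allows \<open>X\<close>
  and \<open>Y\<close> to be compared without a change of variables in the densities.\<close>

lemma
  assumes "prob_space M" and X: "distributed M lborel X (\<lambda>x. ennreal (f m x))"
    and nonneg: "\<And>x. 0 \<le> f m x"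
  shows distributed_imp_integrable: "integrable lborel (f m)"
    and dist_fun_eq_measure: "dist_fun f m x = measure M (X -` {..x} \<inter> space M)"
proof -
  interpret prob_space M by fact
  have meas [measurable]: "f m \<in> borel_measurable borel"
    using distributed_real_measurable[OF _ X] nonneg by simp
  have "(\<integral>\<^sup>+x. ennreal (f m x) \<partial>lborel) = emeasure M (X -` UNIV \<inter> space M)"
    using distributed_emeasure[OF X, of UNIV] by simp
  also have "\<dots> = ennreal 1"
    by (simp add: emeasure_space_1)
  finally show int: "integrable lborel (f m)"
    by (intro integrableI_nn_integral_finite[of _ _ 1]) (auto simp: nonneg)
  have pos: "0 \<le> dist_fun f m x"
    unfolding dist_fun_def by (rule set_integral_nonneg_real) (rule nonneg)
  have "emeasure M (X -` {..x} \<inter> space M) = (\<integral>\<^sup>+t. ennreal (f m t) * indicator {..x} t \<partial>lborel)"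
    by (rule distributed_emeasure[OF X]) simp
  also have "\<dots> = (\<integral>\<^sup>+t. ennreal (indicator {..x} t *\<^sub>R f m t) \<partial>lborel)"
    by (intro nn_integral_cong) (auto split: split_indicator)
  also have "\<dots> = ennreal (dist_fun f m x)"
    unfolding dist_fun_def set_lebesgue_integral_def
    by (intro nn_integral_eq_integral integrable_mult_indicator int) (auto simp: nonneg)
  finally show "dist_fun f m x = measure M (X -` {..x} \<inter> space M)"
    using pos by (simp add: measure_def)
qed

subsection \<open>Transfer of fragility\<close>

text \<open>Smallness of \<open>C\<close> at one point \<open>b - 1 - real n\<close> controls
  \<open>q\<close> on the whole half line below it, since \<open>q\<close> increases;
  \<open>C\<close> itself may be non-monotone.\<close>

lemma tendsto_0_at_bot_of_sequence:
  fixes q C :: "real \<Rightarrow> real"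
  assumes mono: "\<And>x y. \<lbrakk>x \<le> y; y < b\<rbrakk> \<Longrightarrow> q x \<le> q y"
    and bound: "\<And>x. x < b \<Longrightarrow> 0 \<le> q x \<and> q x \<le> C x"
    and lim: "(\<lambda>n. C (b - 1 - real n)) \<longlonglongrightarrow> 0"
  shows "(q \<longlongrightarrow> 0) at_bot"
proof (rule tendstoI)
  fix e :: real assume "e > 0"
  then have "\<forall>\<^sub>F n in sequentially. C (b - 1 - real n) < e"
    by (rule order_tendstoD(2)[OF lim])
  then obtain n where n: "C (b - 1 - real n) < e"
    by (auto simp: eventually_sequentially)
  have "dist (q x) 0 < e" if "x \<le> b - 1 - real n" for x
    using mono[OF that] bound[of x] bound[of "b - 1 - real n"] n that by simp
  then show "\<forall>\<^sub>F x in at_bot. dist (q x) 0 < e"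
    unfolding eventually_at_bot_linorder by blast
qed

theorem theorem1:
  fixes M :: "real \<Rightarrow> 'a measure" and X :: "'a \<Rightarrow> real"
    and f g :: "real \<Rightarrow> real \<Rightarrow> real" and I :: "real set"
    and \<Omega> K l :: real and \<phi> :: "real \<Rightarrow> real"
  assumes prob: "\<And>m. m \<in> I \<Longrightarrow> prob_space (M m)"
    and f_nonneg: "\<And>m x. m \<in> I \<Longrightarrow> 0 \<le> f m x"
    and X_pdf: "\<And>m. m \<in> I \<Longrightarrow> distributed (M m) lborel X (\<lambda>x. ennreal (f m x))"
    and standing: "standing_assumptions \<Omega> I f"
    and "K < \<Omega>"
    and "l \<in> I" and "semi_deviation \<Omega> f l > 0"
    and phi_mono: "strict_mono \<phi>"
    and phi_diff: "\<And>x. \<phi> differentiable (at x)"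
    and phi_diff2: "\<And>x. deriv \<phi> differentiable (at x)"
    and phi_Omega: "\<phi> \<Omega> = \<Omega>"
    and phi_deriv_pos: "\<And>x. x < \<Omega> \<Longrightarrow> deriv \<phi> x > 0"
    and g_nonneg: "\<And>m y. m \<in> I \<Longrightarrow> 0 \<le> g m y"
    and Y_pdf: "\<And>m. m \<in> I \<Longrightarrow> distributed (M m) lborel (\<lambda>\<omega>. \<phi> (X \<omega>)) (\<lambda>y. ennreal (g m y))"
    and X_fragility: "fragility_well_defined \<Omega> I f l"
    and Y_fragility: "fragility_well_defined \<Omega> I g l"
    and integral_exists:
      "(\<lambda>x. transfer_kernel \<Omega> f K l x * deriv (deriv \<phi>) x) integrable_on {..\<Omega>}"
  shows "fragility \<Omega> I g (\<phi> K) (semi_deviation \<Omega> g l)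
           > fragility \<Omega> I f K (semi_deviation \<Omega> f l)
         \<longleftrightarrow> integral {..\<Omega>} (\<lambda>x. transfer_kernel \<Omega> f K l x * deriv (deriv \<phi>) x) < 0"
proof -

  \<comment> \<open>Derivatives of \<phi> and dependence of the law of \<open>X\<close> on the
    parameter\<close>
  define \<psi> where "\<psi> = deriv \<phi>"
  define \<psi>' where "\<psi>' = deriv \<psi>"
  have phi: "(\<phi> has_real_derivative \<psi> x) (at x)" for x
    using phi_diff[of x] by (simp add: \<psi>_def DERIV_deriv_iff_real_differentiable)
  have psi: "(\<psi> has_real_derivative \<psi>' x) (at x)" for x
    using phi_diff2[of x] by (simp add: \<psi>_def \<psi>'_def DERIV_deriv_iff_real_differentiable)
  have psi_pos: "0 < \<psi> x" if "x < \<Omega>" for x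
    using phi_deriv_pos[OF that] by (simp add: \<psi>_def)
  have phi_less: "\<phi> x < \<Omega> \<longleftrightarrow> x < \<Omega>" for x
    using strict_mono_less[OF phi_mono, of x \<Omega>] phi_Omega by simp

  have s_strict: "strict_mono_on I (semi_deviation \<Omega> f)"
    and s_range: "semi_deviation \<Omega> f ` I = {0..}" and I_interval: "is_interval I"
    and F_deriv: "\<And>m x. \<lbrakk>m \<in> I; x < \<Omega>\<rbrakk> \<Longrightarrow>
      \<exists>D>0. ((\<lambda>m. dist_fun f m x) has_real_derivative D) (at m within I)"
    using standing unfolding standing_assumptions_def by auto
  \<comment> \<open>The deviation at \<open>l\<close> lies strictly between two attained values, 0
    and itself plus 1, so \<open>l\<close> lies strictly between two points of the interval
    \<open>I\<close>.\<close>
  have l_interior: "l \<in> interior I"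
  proof -
    have "0 \<in> semi_deviation \<Omega> f ` I" "semi_deviation \<Omega> f l + 1 \<in> semi_deviation \<Omega> f ` I"
      unfolding s_range using \<open>semi_deviation \<Omega> f l > 0\<close> by simp_all
    then obtain a b where ab: "a \<in> I" "b \<in> I" "semi_deviation \<Omega> f a < semi_deviation \<Omega> f l"
        "semi_deviation \<Omega> f l < semi_deviation \<Omega> f b"
      using \<open>semi_deviation \<Omega> f l > 0\<close> by fastforce
    then have "a < l" "l < b"
      using strict_mono_on_less[OF s_strict] \<open>l \<in> I\<close> by auto
    moreover have "{a<..<b} \<subseteq> I"
      using I_interval ab(1,2) unfolding is_interval_1 by (meson greaterThanLessThan_iff less_imp_le subsetI)
    ultimately show ?thesis
      by (intro interiorI[of "{a<..<b}"]) auto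
  qed
  have F_deriv_at: "\<exists>D>0. ((\<lambda>m. dist_fun f m x) has_real_derivative D) (at l)" if "x < \<Omega>" for x
    using F_deriv[OF \<open>l \<in> I\<close> that] at_within_interior[OF l_interior] by simp
  have F_strict: "dist_fun f m x < dist_fun f n x" if mn: "m \<in> I" "n \<in> I" "m < n" and x: "x < \<Omega>" for m n x
  proof -
    have sub: "{m..n} \<subseteq> I"
      using I_interval mn unfolding is_interval_1 by (meson atLeastAtMost_iff subsetI)
    have der: "\<exists>D>0. ((\<lambda>m. dist_fun f m x) has_real_derivative D) (at t within {m..n})"
      if "t \<in> {m..n}" for t
      using F_deriv[of t x] that x sub by (blast intro: DERIV_subset)
    \<comment> \<open>At the end points of \<open>{m..n}\<close> the derivative may be one-sided;
      the criterion used asks only for continuity there.\<close>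
    show ?thesis
    proof (rule DERIV_pos_imp_increasing_open[OF \<open>m < n\<close>])
      fix t assume t: "m < t" "t < n"
      then show "\<exists>D. ((\<lambda>m. dist_fun f m x) has_real_derivative D) (at t) \<and> 0 < D"
        using der[of t] by (auto simp: at_within_Icc_at)
    next
      show "continuous_on {m..n} (\<lambda>m. dist_fun f m x)"
        unfolding continuous_on_eq_continuous_within
        using der by (blast intro: DERIV_continuous)
    qed
  qed

  have f_measurable: "f m \<in> borel_measurable borel" and g_measurable: "g m \<in> borel_measurable borel"
    if "m \<in> I" for m
    using distributed_real_measurable[OF _ X_pdf[OF that]] distributed_real_measurable[OF _ Y_pdf[OF that]]
      f_nonneg[OF that] g_nonneg[OF that] by simp_all
  interpret X: density_family \<Omega> I f
    using X_fragility f_measurable f_nonneg distributed_imp_integrable[where f = f, OF prob X_pdf f_nonneg]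
    by unfold_locales (auto simp: fragility_well_defined_def)
  interpret Y: density_family \<Omega> I g
    using Y_fragility g_measurable g_nonneg distributed_imp_integrable[where f = g, OF prob Y_pdf g_nonneg]
    by unfold_locales (auto simp: fragility_well_defined_def)

  \<comment> \<open>Comparison of the distribution functions of \<open>X\<close> and
    \<open>Y\<close>\<close>
  have G_phi: "dist_fun g m (\<phi> x) = dist_fun f m x" if "m \<in> I" for m x
  proof -
    have "(\<lambda>\<omega>. \<phi> (X \<omega>)) -` {..\<phi> x} = X -` {..x}"
      using strict_mono_less_eq[OF phi_mono] by auto
    then show ?thesis
      using dist_fun_eq_measure[where f = f, OF prob[OF that] X_pdf[OF that] f_nonneg[OF that], of x]
        dist_fun_eq_measure[where f = g, OF prob[OF that] Y_pdf[OF that] g_nonneg[OF that], of "\<phi> x"] by simp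
  qed
  \<comment> \<open>This covers a \<phi> that is bounded below: levels left of its range carry no
    mass.\<close>
  have G_null: "dist_fun g m y = 0" if "m \<in> I" "\<And>x. y < \<phi> x" for m y
  proof -
    have "\<not> \<phi> x \<le> y" for x
      using that(2)[of x] by simp
    then have "(\<lambda>\<omega>. \<phi> (X \<omega>)) -` {..y} = {}"
      by auto
    then show ?thesis
      using dist_fun_eq_measure[where f = g, OF prob[OF that(1)] Y_pdf[OF that(1)] g_nonneg[OF that(1)], of y] by simp
  qed
  \<comment> \<open>Vacuous, since no real lies below all reals; it is the form that the decay lemma
    takes for the identity map.\<close>
  have F_null: "dist_fun f m y = 0" if "m \<in> I" "\<And>x. y < x" for m y
    using that(2)[of y] by simp
  have F_mono: "dist_fun f m x \<le> dist_fun f n x" if "m \<in> I" "n \<in> I" "m \<le> n" "x < \<Omega>" for m n x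
    using F_strict[of m n x] that by (cases "m = n") auto
  have G_mono: "dist_fun g m y \<le> dist_fun g n y" if mn: "m \<in> I" "n \<in> I" "m \<le> n" "y < \<Omega>" for m n y
  proof (cases "\<forall>x. y < \<phi> x")
    case False
    then obtain x0 where x0: "\<phi> x0 \<le> y" by (auto simp: not_less)
    then have "x0 < \<Omega>" using phi_less[of x0] mn(4) by linarith
    then obtain x where "\<phi> x = y"
      using IVT'[of \<phi> x0 y \<Omega>] x0 mn(4) phi_Omega phi
      by (metis DERIV_isCont continuous_at_imp_continuous_on less_imp_le)
    then show ?thesis
      using G_phi F_mono[of m n x] mn phi_less[of x] by auto
  qed (use G_null mn in auto)

  \<comment> \<open>As functions of the strike, the price differences for \<open>Y\<close> and
    \<open>X\<close> have derivatives with ratio \<open>\<psi> x\<close>; this is the origin of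
    \<open>dr = \<psi> dp\<close>.\<close>
  have R_deriv: "((\<lambda>x. put_price g n (\<phi> x) - put_price g m (\<phi> x)) has_real_derivative
      (dist_fun f n x - dist_fun f m x) * \<psi> x) (at x)" if "m \<in> I" "n \<in> I" for m n x
    using DERIV_diff[OF DERIV_chain2[OF Y.has_real_derivative_put_price[OF that(2)] phi[of x]]
        DERIV_chain2[OF Y.has_real_derivative_put_price[OF that(1)] phi[of x]]] that
    by (simp add: G_phi left_diff_distrib)
  have P_deriv: "((\<lambda>x. put_price f n x - put_price f m x) has_real_derivative
      dist_fun f n x - dist_fun f m x) (at x)" if "m \<in> I" "n \<in> I" for m n x
    using that by (intro DERIV_diff X.has_real_derivative_put_price)
  have "semi_deviation \<Omega> g m < semi_deviation \<Omega> g n" if mn: "m \<in> I" "n \<in> I" "m < n" for m n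
  proof -
    \<comment> \<open>The price difference between parameters is nonnegative at strike
      \<open>\<phi> (\<Omega> - 1)\<close> and strictly increases up to \<open>\<Omega>\<close>,
      where it is the difference of the semi-deviations of \<open>Y\<close>.\<close>
    have "put_price g n (\<phi> (\<Omega> - 1)) - put_price g m (\<phi> (\<Omega> - 1))
        < put_price g n (\<phi> \<Omega>) - put_price g m (\<phi> \<Omega>)"
    proof (rule DERIV_pos_imp_increasing_open[where a = "\<Omega> - 1" and b = \<Omega>
          and f = "\<lambda>x. put_price g n (\<phi> x) - put_price g m (\<phi> x)"])
      fix x assume "\<Omega> - 1 < x" "x < \<Omega>"
      then show "\<exists>D. ((\<lambda>x. put_price g n (\<phi> x) - put_price g m (\<phi> x)) has_real_derivative D) (at x) \<and> 0 < D"
        using R_deriv[OF mn(1,2), of x] F_strict[OF mn, of x] psi_pos[of x]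
        by (intro exI[of _ "(dist_fun f n x - dist_fun f m x) * \<psi> x"]) simp
    qed (auto intro!: continuous_at_imp_continuous_on DERIV_isCont[OF R_deriv] mn)
    moreover have "put_price g m (\<phi> (\<Omega> - 1)) \<le> put_price g n (\<phi> (\<Omega> - 1))"
      using mn phi_less[of "\<Omega> - 1"] by (intro Y.put_price_mono G_mono) auto
    ultimately show ?thesis
      using mn by (simp add: Y.semi_deviation_eq_put_price phi_Omega)
  qed
  then have "strict_mono_on I (semi_deviation \<Omega> g)"
    by (rule strict_mono_onI)
  note inj = strict_mono_on_imp_inj_on[OF this] strict_mono_on_imp_inj_on[OF s_strict]

  interpret X: fragile_family \<Omega> I f l
  proof
    show "\<exists>K<\<Omega>. \<exists>D>0. ((\<lambda>m. dist_fun f m K) has_real_derivative D) (at l)"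
      using F_deriv_at[OF \<open>K < \<Omega>\<close>] \<open>K < \<Omega>\<close> by blast
  qed (use l_interior X_fragility inj F_mono in auto)
  have G_deriv: "((\<lambda>m. dist_fun g m (\<phi> x)) has_real_derivative D) (at l)"
    if "((\<lambda>m. dist_fun f m x) has_real_derivative D) (at l)" for x D
    using that by (rule X.DERIV_cong_params) (simp add: G_phi)
  interpret Y: fragile_family \<Omega> I g l
  proof
    show "\<exists>K<\<Omega>. \<exists>D>0. ((\<lambda>m. dist_fun g m K) has_real_derivative D) (at l)"
      using F_deriv_at[OF \<open>K < \<Omega>\<close>] \<open>K < \<Omega>\<close> G_deriv phi_less by blast
  qed (use l_interior Y_fragility inj G_mono in auto)

  \<comment> \<open>Parameter derivatives of the put prices\<close>
  define p where "p x = deriv (\<lambda>m. put_price f m x) l" for x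
  define r where "r x = deriv (\<lambda>m. put_price g m (\<phi> x)) l" for x
  obtain D where D: "\<And>x. x < \<Omega> \<Longrightarrow> 0 < D x \<and> ((\<lambda>m. dist_fun f m x) has_real_derivative D x) (at l)"
    using F_deriv_at by metis
  have p_below: "((\<lambda>m. put_price f m x) has_real_derivative X.shortfall_sensitivity x - (\<Omega> - x) * D x) (at l)"
    if "x < \<Omega>" for x
    using X.has_real_derivative_put_price_param that D by blast
  have r_below: "((\<lambda>m. put_price g m (\<phi> x)) has_real_derivative
      Y.shortfall_sensitivity (\<phi> x) - (\<Omega> - \<phi> x) * D x) (at l)" if "x < \<Omega>" for x
    using Y.has_real_derivative_put_price_param that D G_deriv phi_less by blast
  have p_end: "p \<Omega> = deriv (semi_deviation \<Omega> f) l" and r_end: "r \<Omega> = deriv (semi_deviation \<Omega> g) l"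
    using DERIV_imp_deriv[OF X.has_real_derivative_put_price_end]
      DERIV_imp_deriv[OF Y.has_real_derivative_put_price_end] by (simp_all add: p_def r_def phi_Omega)
  \<comment> \<open>Below \<open>\<Omega>\<close> differentiability comes from the shortfall; at
    \<open>\<Omega>\<close> it comes from the semi-deviation.\<close>
  have p: "((\<lambda>m. put_price f m x) has_real_derivative p x) (at l)" if "x \<le> \<Omega>" for x
  proof (cases "x = \<Omega>")
    case True
    then show ?thesis using X.has_real_derivative_put_price_end p_end by simp
  next
    case False
    then show ?thesis
      using that p_below[of x] DERIV_imp_deriv[OF p_below[of x]] by (simp add: p_def)
  qed
  have r: "((\<lambda>m. put_price g m (\<phi> x)) has_real_derivative r x) (at l)" if "x \<le> \<Omega>" for x
  proof (cases "x = \<Omega>")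
    case True
    then show ?thesis using Y.has_real_derivative_put_price_end r_end by (simp add: phi_Omega)
  next
    case False
    then show ?thesis
      using that r_below[of x] DERIV_imp_deriv[OF r_below[of x]] by (simp add: r_def)
  qed
  have phi_le: "\<phi> x \<le> \<phi> y \<longleftrightarrow> x \<le> y" "\<phi> x \<le> \<Omega> \<longleftrightarrow> x \<le> \<Omega>" for x y
    using strict_mono_less_eq[OF phi_mono] phi_Omega by metis+
  have p_mono: "p x \<le> p y" and r_mono: "r x \<le> r y" if "x \<le> y" "y \<le> \<Omega>" for x y
    using that X.put_price_deriv_mono[OF that p p]
      Y.put_price_deriv_mono[of "\<phi> x" "\<phi> y", OF _ _ r r] by (simp_all add: phi_le)
  have p_nonneg: "0 \<le> p x" and r_nonneg: "0 \<le> r x" if "x \<le> \<Omega>" for x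
    using that X.put_price_deriv_nonneg[OF _ p] Y.put_price_deriv_nonneg[OF _ r] by (simp_all add: phi_le)
  have p_eq: "X.shortfall_sensitivity x = p x + (\<Omega> - x) * D x"
    and r_eq: "Y.shortfall_sensitivity (\<phi> x) = r x + (\<Omega> - \<phi> x) * D x" if "x < \<Omega>" for x
    using DERIV_unique[OF p p_below] DERIV_unique[OF r r_below] that by simp_all

  \<comment> \<open>Increments of \<open>r\<close> against increments of \<open>p\<close>\<close>
  have bounds: "lo * (p v - p u) \<le> r v - r u \<and> r v - r u \<le> hi * (p v - p u)"
    if uv: "u \<le> v" "v \<le> \<Omega>" and psi_bd: "\<And>x. \<lbrakk>u \<le> x; x \<le> v\<rbrakk> \<Longrightarrow> lo \<le> \<psi> x \<and> \<psi> x \<le> hi"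
    for u v lo hi
  proof (cases "u = v")
    case False
    let ?P = "\<lambda>m. put_price f m v - put_price f m u" and ?R = "\<lambda>m. put_price g m (\<phi> v) - put_price g m (\<phi> u)"
    have step: "lo * (?P m - ?P l) \<le> ?R m - ?R l \<and> ?R m - ?R l \<le> hi * (?P m - ?P l)"
      if m: "m \<in> I" "l \<le> m" for m
    proof (cases "m = l")
      case False
      then have "l < m" using m by simp
      \<comment> \<open>Cauchy's mean value theorem in the strike, for the two fixed parameters
        \<open>l\<close> and \<open>m\<close>. The common factor is nonzero by
        \<open>F_strict\<close> and cancels.\<close>
      have "\<exists>c. u < c \<and> c < v \<and>
        ((put_price g m (\<phi> v) - put_price g l (\<phi> v)) - (put_price g m (\<phi> u) - put_price g l (\<phi> u)))
          * (dist_fun f m c - dist_fun f l c)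
        = ((put_price f m v - put_price f l v) - (put_price f m u - put_price f l u))
          * ((dist_fun f m c - dist_fun f l c) * \<psi> c)"
        using uv \<open>u \<noteq> v\<close> R_deriv[OF \<open>l \<in> I\<close> m(1)] P_deriv[OF \<open>l \<in> I\<close> m(1)]
        by (intro GMVT') (auto intro: DERIV_isCont)
      then obtain c where c: "u < c" "c < v"
        "(?R m - ?R l) * (dist_fun f m c - dist_fun f l c)
          = (?P m - ?P l) * ((dist_fun f m c - dist_fun f l c) * \<psi> c)"
        by (auto simp: algebra_simps)
      have "dist_fun f m c - dist_fun f l c \<noteq> 0"
        using F_strict[OF \<open>l \<in> I\<close> m(1) \<open>l < m\<close>, of c] c uv by simp
      moreover have "(?R m - ?R l) * (dist_fun f m c - dist_fun f l c)
          = (\<psi> c * (?P m - ?P l)) * (dist_fun f m c - dist_fun f l c)"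
        using c(3) by (simp only: mult_ac)
      ultimately have "?R m - ?R l = \<psi> c * (?P m - ?P l)"
        by (metis mult_right_cancel)
      moreover have "put_price f m u - put_price f l u \<le> put_price f m v - put_price f l v"
        using uv m \<open>l \<in> I\<close> by (intro X.put_price_diff_mono F_mono) auto
      then have "0 \<le> ?P m - ?P l"
        by simp
      ultimately show ?thesis
        using psi_bd[of c] c by (simp add: mult_right_mono)
    qed simp
    \<comment> \<open>\<open>step\<close> says that \<open>?R - lo * ?P\<close> at \<open>m\<close>
      is at least its value at \<open>l\<close>, so its derivative at \<open>l\<close> is
      nonnegative; likewise for \<open>hi\<close> with the signs reversed.\<close>
    have "0 \<le> (r v - r u) - lo * (p v - p u)"
    proof (rule DERIV_nonneg_of_le_right[where h = "\<lambda>m. ?R m - lo * ?P m" and l = l])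
      show "\<forall>\<^sub>F m in at_right l. ?R l - lo * ?P l \<le> ?R m - lo * ?P m"
        using X.eventually_mem by eventually_elim (use step in \<open>force simp: right_diff_distrib\<close>)
    qed (use uv in \<open>auto intro!: DERIV_diff DERIV_cmult p r\<close>)
    moreover have "0 \<le> hi * (p v - p u) - (r v - r u)"
    proof (rule DERIV_nonneg_of_le_right[where h = "\<lambda>m. hi * ?P m - ?R m" and l = l])
      show "\<forall>\<^sub>F m in at_right l. hi * ?P l - ?R l \<le> hi * ?P m - ?R m"
        using X.eventually_mem by eventually_elim (use step in \<open>force simp: right_diff_distrib\<close>)
    qed (use uv in \<open>auto intro!: DERIV_diff DERIV_cmult p r\<close>)
    ultimately show ?thesis by simp
  qed simp

  \<comment> \<open>Decay of \<open>p\<close> and \<open>r\<close> at minus infinity\<close>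
  have lim_p: "(p \<longlongrightarrow> 0) at_bot"
  proof (rule tendsto_0_at_bot_of_sequence[where C = X.shortfall_sensitivity and b = \<Omega>])
    show "(\<lambda>n. X.shortfall_sensitivity (\<Omega> - 1 - real n)) \<longlonglongrightarrow> 0"
      using X.shortfall_sensitivity_tendsto_0[of "\<lambda>x. x"] F_null by (simp add: strict_mono_def)
    show "0 \<le> p x \<and> p x \<le> X.shortfall_sensitivity x" if "x < \<Omega>" for x
      using p_nonneg[of x] p_eq[OF that] D[OF that] that by (simp add: less_imp_le)
  qed (use p_mono in auto)
  have lim_r: "(r \<longlongrightarrow> 0) at_bot"
  proof (rule tendsto_0_at_bot_of_sequence[where C = "\<lambda>x. Y.shortfall_sensitivity (\<phi> x)" and b = \<Omega>])
    show "(\<lambda>n. Y.shortfall_sensitivity (\<phi> (\<Omega> - 1 - real n))) \<longlonglongrightarrow> 0"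
      using phi_mono phi_Omega G_null by (rule Y.shortfall_sensitivity_tendsto_0)
    show "0 \<le> r x \<and> r x \<le> Y.shortfall_sensitivity (\<phi> x)" if "x < \<Omega>" for x
      using r_nonneg[of x] r_eq[OF that] D[OF that] that phi_less[of x] by (simp add: less_imp_le)
  qed (use r_mono in auto)

  \<comment> \<open>Evaluation of the kernel integral\<close>
  define c where "c = X.shortfall_sensitivity K"
  \<comment> \<open>\<open>c\<close> plays two roles: numerator of the fragility of
    \<open>X\<close>, and derivative of the barrier put price at strike \<open>\<Omega>\<close>,
    which normalizes the kernel.\<close>
  have c: "c = p K + (\<Omega> - K) * D K"
    unfolding c_def by (rule p_eq[OF \<open>K < \<Omega>\<close>])
  have "c > 0"
    unfolding c using p_nonneg[of K] D[OF \<open>K < \<Omega>\<close>] \<open>K < \<Omega>\<close> by (simp add: add_nonneg_pos)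
  have above: "deriv (\<lambda>m. barrier_put_price f K m x) l = p K + (x - K) * D K" if "K \<le> x" for x
  proof (rule DERIV_imp_deriv, rule X.DERIV_cong_params)
    show "((\<lambda>m. put_price f m K + (x - K) * dist_fun f m K) has_real_derivative p K + (x - K) * D K) (at l)"
      using \<open>K < \<Omega>\<close> D by (intro DERIV_add DERIV_cmult p) auto
  qed (use X.barrier_put_price_above that in auto)
  have H: "transfer_kernel \<Omega> f K l x
      = (if x \<le> K then p x else p K + (x - K) * D K) / c - p x / p \<Omega>" for x
    unfolding transfer_kernel_def using above[of x] above[of \<Omega>] \<open>K < \<Omega>\<close>
    by (simp add: X.barrier_put_price_below c p_def)
  have s'_pos: "0 < p \<Omega>" and u'_pos: "0 < r \<Omega>"
    unfolding p_end r_end by (fact X.semi_deviation_deriv_pos Y.semi_deviation_deriv_pos)+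
  have int: "(\<lambda>x. transfer_kernel \<Omega> f K l x * \<psi>' x) integrable_on {..\<Omega>}"
    using integral_exists by (simp add: \<psi>_def \<psi>'_def)
  have "integral {..\<Omega>} (\<lambda>x. transfer_kernel \<Omega> f K l x * \<psi>' x)
      = r \<Omega> / p \<Omega> - (r K + (\<Omega> - \<phi> K) * D K) / c"
    by (rule integral_transfer_kernel[OF \<open>K < \<Omega>\<close> phi_Omega phi psi psi_pos p_mono p_nonneg s'_pos
          bounds lim_p lim_r c \<open>c > 0\<close> H int])
  moreover have "fragility \<Omega> I g (\<phi> K) (semi_deviation \<Omega> g l) = (r K + (\<Omega> - \<phi> K) * D K) / r \<Omega>"
    using Y.fragility_eq[of "\<phi> K"] r_eq[OF \<open>K < \<Omega>\<close>] \<open>K < \<Omega>\<close> by (simp add: phi_less r_end)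
  moreover have "fragility \<Omega> I f K (semi_deviation \<Omega> f l) = c / p \<Omega>"
    using X.fragility_eq[OF \<open>K < \<Omega>\<close>] by (simp add: c_def p_end)
  \<comment> \<open>With \<open>e\<close> the numerator of the fragility of \<open>Y\<close>, both
    sides say \<open>c * r \<Omega> < e * p \<Omega>\<close>.\<close>
  moreover have "c / p \<Omega> < e / r \<Omega> \<longleftrightarrow> r \<Omega> / p \<Omega> - e / c < 0" for e
    using \<open>c > 0\<close> s'_pos u'_pos by (simp add: field_simps)
  ultimately show ?thesis
    unfolding \<psi>_def \<psi>'_def by simp
qed

end
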